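(* Let $n$ be an odd positive integer. Every $n$:1-periodic orbit of $$h'(t)=-\operatorname{sign}(h(t-\tau))+c\cos(2\pi t)$$ is symmetric, i.e. satisfies $h(t)=-h(t+n/2)$ for all $t\in\mathbb{R}$.
   Context: Parameters: $c\ge0$ and delay $\tau>0$; $\operatorname{sign}(0)=0$. A solution is a locally absolutely continuous function satisfying the equation for almost every $t$. The set $Z$ of nondegenerate zeros of $h$ consists of all $z$ with $h(z)=0$ for which there is $\delta>0$ with $h(z_-)h(z_+)<0$ for all $z_-\in(z-\delta,z)$, $z_+\in(z,z+\delta)$; $Z^+\subset Z$ is the subset of upward crossings ($h(z_-)<0<h(z_+)$). Periodic orbits are solutions on $\mathbb{R}$ with finitely many zeros per period. An $n$:1-periodic orbit is a periodic orbit of prime period $n\in\mathbb{N}$ with exactly one upward crossing (element of $Z^+$) per period. *)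

theory Defs
  imports "HOL-Analysis.Analysis"
begin

text \<open>
  Absolute continuity on a compact interval, in its \<open>\<epsilon>\<close>-\<open>\<delta>\<close> form. The finite families of
  non-overlapping subintervals are those \<open>D\<close> with \<open>D division_of \<Union>D\<close> (with \<open>\<Union>D\<close> not
  necessarily an interval); \<open>Inf K\<close> and \<open>Sup K\<close> are the endpoints of a member \<open>K\<close>.
  The constant \<open>absolutely_continuous\<close> of the library is about measures.
\<close>

definition absolutely_continuous_fun :: "real \<Rightarrow> real \<Rightarrow> (real \<Rightarrow> real) \<Rightarrow> bool" where
  "absolutely_continuous_fun a b f \<longleftrightarrow>
     (\<forall>\<epsilon>>0. \<exists>\<delta>>0. \<forall>D. D division_of \<Union>D \<and> \<Union>D \<subseteq> {a..b} \<and> (\<Sum>K\<in>D. Sup K - Inf K) < \<delta> \<longrightarrow>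
        (\<Sum>K\<in>D. \<bar>f (Sup K) - f (Inf K)\<bar>) < \<epsilon>)"

definition locally_absolutely_continuous :: "(real \<Rightarrow> real) \<Rightarrow> bool" where
  "locally_absolutely_continuous f \<longleftrightarrow> (\<forall>a b. a \<le> b \<longrightarrow> absolutely_continuous_fun a b f)"

definition dde_solution :: "real \<Rightarrow> real \<Rightarrow> (real \<Rightarrow> real) \<Rightarrow> bool" where
  "dde_solution c \<tau> h \<longleftrightarrow>
     locally_absolutely_continuous h \<and>
     (AE t in lebesgue.
        (h has_real_derivative - sgn (h (t - \<tau>)) + c * cos (2 * pi * t)) (at t))"

definition nondegenerate_zeros :: "(real \<Rightarrow> real) \<Rightarrow> real set" where
  "nondegenerate_zeros h =
     {z. h z = 0 \<and> (\<exists>\<delta>>0. \<forall>z1\<in>{z-\<delta><..<z}. \<forall>z2\<in>{z<..<z+\<delta>}. h z1 * h z2 < 0)}"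

definition upward_crossings :: "(real \<Rightarrow> real) \<Rightarrow> real set" where
  "upward_crossings h =
     {z \<in> nondegenerate_zeros h.
        \<exists>\<delta>>0. \<forall>z1\<in>{z-\<delta><..<z}. \<forall>z2\<in>{z<..<z+\<delta>}. h z1 < 0 \<and> 0 < h z2}"

definition is_period :: "(real \<Rightarrow> real) \<Rightarrow> real \<Rightarrow> bool" where
  "is_period h T \<longleftrightarrow> 0 < T \<and> (\<forall>t. h (t + T) = h t)"

definition prime_period :: "(real \<Rightarrow> real) \<Rightarrow> real \<Rightarrow> bool" where
  "prime_period h T \<longleftrightarrow> is_period h T \<and> (\<forall>S. is_period h S \<longrightarrow> T \<le> S)"

text \<open>
  ``Per period'' is read as: in the half-open window \<open>[0, T)\<close>. By periodicity, every other
  window \<open>[a, a + T)\<close> gives the same counts.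
\<close>

definition periodic_orbit :: "real \<Rightarrow> real \<Rightarrow> (real \<Rightarrow> real) \<Rightarrow> bool" where
  "periodic_orbit c \<tau> h \<longleftrightarrow>
     dde_solution c \<tau> h \<and> (\<exists>T. is_period h T \<and> finite {t \<in> {0..<T}. h t = 0})"

definition n_1_periodic_orbit :: "real \<Rightarrow> real \<Rightarrow> nat \<Rightarrow> (real \<Rightarrow> real) \<Rightarrow> bool" where
  "n_1_periodic_orbit c \<tau> n h \<longleftrightarrow>
     periodic_orbit c \<tau> h \<and> prime_period h (real n) \<and>
     card (upward_crossings h \<inter> {0..<real n}) = 1"

definition symmetric_orbit :: "nat \<Rightarrow> (real \<Rightarrow> real) \<Rightarrow> bool" where
  "symmetric_orbit n h \<longleftrightarrow> (\<forall>t. h t = - h (t + real n / 2))"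

end

theory Submission
  imports Defs
begin

text \<open>
  Let \<open>p\<close> be the upward crossing. Within the period \<open>(p, p + n)\<close> the orbit changes sign exactly
  once, at some \<open>d\<close>, so the delayed equation integrates on \<open>[p + \<tau>, p + n + \<tau>]\<close> to
  \<open>h(t) = |t - \<tau> - d| + c sin(2\<pi>t) / (2\<pi>) + C\<close>. Equal values at the two endpoints force
  \<open>d = p + n/2\<close>. Since \<open>n\<close> is odd, the sine term changes sign under the shift by \<open>n/2\<close>, so
  \<open>h(t) + h(t + n/2)\<close> is constant on half a period, hence everywhere, and it vanishes at \<open>p\<close>.
  Passing from the equation, which holds only almost everywhere, to the explicit formula uses that
  an absolutely continuous function with derivative zero almost everywhere is constant.
\<close>

section \<open>Absolute continuity on compact intervals\<close>

lemma division_of_real_memberE: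
  fixes K :: "real set"
  assumes "D division_of S" "K \<in> D"
  obtains u v where "u \<le> v" "K = {u..v}" "Inf K = u" "Sup K = v"
proof -
  obtain u v where "K = cbox u v" "K \<noteq> {}"
    using assms cbox_division_memE by metis
  then show thesis
    using that[of u v] by auto
qed

lemma absolutely_continuous_fun_diff:
  assumes f: "absolutely_continuous_fun a b f" and g: "absolutely_continuous_fun a b g"
  shows "absolutely_continuous_fun a b (\<lambda>x. f x - g x)"
  unfolding absolutely_continuous_fun_def
proof (intro allI impI)
  fix \<epsilon> :: real
  assume "\<epsilon> > 0"
  then have e2: "\<epsilon> / 2 > 0" by simp
  obtain \<delta>1 where \<delta>1: "\<delta>1 > 0"
    "\<And>D. D division_of \<Union>D \<and> \<Union>D \<subseteq> {a..b} \<and> (\<Sum>K\<in>D. Sup K - Inf K) < \<delta>1 \<Longrightarrow>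
        (\<Sum>K\<in>D. \<bar>f (Sup K) - f (Inf K)\<bar>) < \<epsilon> / 2"
    using f e2 unfolding absolutely_continuous_fun_def by meson
  obtain \<delta>2 where \<delta>2: "\<delta>2 > 0"
    "\<And>D. D division_of \<Union>D \<and> \<Union>D \<subseteq> {a..b} \<and> (\<Sum>K\<in>D. Sup K - Inf K) < \<delta>2 \<Longrightarrow>
        (\<Sum>K\<in>D. \<bar>g (Sup K) - g (Inf K)\<bar>) < \<epsilon> / 2"
    using g e2 unfolding absolutely_continuous_fun_def by meson
  have "(\<Sum>K\<in>D. \<bar>(f (Sup K) - g (Sup K)) - (f (Inf K) - g (Inf K))\<bar>) < \<epsilon>"
    if D: "D division_of \<Union>D \<and> \<Union>D \<subseteq> {a..b} \<and> (\<Sum>K\<in>D. Sup K - Inf K) < min \<delta>1 \<delta>2" for D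
  proof -
    have "(\<Sum>K\<in>D. \<bar>(f (Sup K) - g (Sup K)) - (f (Inf K) - g (Inf K))\<bar>)
        \<le> (\<Sum>K\<in>D. \<bar>f (Sup K) - f (Inf K)\<bar> + \<bar>g (Sup K) - g (Inf K)\<bar>)"
      by (rule sum_mono) arith
    also have "\<dots> < \<epsilon>"
      using \<delta>1(2)[of D] \<delta>2(2)[of D] D by (simp add: sum.distrib)
    finally show ?thesis .
  qed
  then show "\<exists>\<delta>>0. \<forall>D. D division_of \<Union>D \<and> \<Union>D \<subseteq> {a..b} \<and> (\<Sum>K\<in>D. Sup K - Inf K) < \<delta> \<longrightarrow>
      (\<Sum>K\<in>D. \<bar>f (Sup K) - g (Sup K) - (f (Inf K) - g (Inf K))\<bar>) < \<epsilon>"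
    using \<delta>1(1) \<delta>2(1) by (intro exI[of _ "min \<delta>1 \<delta>2"]) simp
qed

lemma lipschitz_imp_absolutely_continuous_fun:
  assumes L: "\<And>x y. \<bar>f x - f y\<bar> \<le> L * \<bar>x - y\<bar>"
  shows "absolutely_continuous_fun a b f"
  unfolding absolutely_continuous_fun_def
proof (intro allI impI)
  fix \<epsilon> :: real
  assume "\<epsilon> > 0"
  have L0: "L \<ge> 0"
    using L[of 1 0] by simp
  have "(\<Sum>K\<in>D. \<bar>f (Sup K) - f (Inf K)\<bar>) < \<epsilon>"
    if D: "D division_of \<Union>D" "(\<Sum>K\<in>D. Sup K - Inf K) < \<epsilon> / (L + 1)" for D
  proof -
    \<comment> \<open>Enlarging the constant to \<open>L + 1\<close> keeps the divisor in the choice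
      of \<delta> positive when \<open>L = 0\<close>.\<close>
    have "(\<Sum>K\<in>D. \<bar>f (Sup K) - f (Inf K)\<bar>) \<le> (\<Sum>K\<in>D. (L + 1) * (Sup K - Inf K))"
    proof (rule sum_mono)
      fix K assume "K \<in> D"
      then obtain u v where "u \<le> v" "Inf K = u" "Sup K = v"
        using division_of_real_memberE[OF D(1)] by metis
      then show "\<bar>f (Sup K) - f (Inf K)\<bar> \<le> (L + 1) * (Sup K - Inf K)"
        using L[of v u] by (simp add: algebra_simps)
    qed
    also have "\<dots> = (L + 1) * (\<Sum>K\<in>D. Sup K - Inf K)"
      by (simp add: sum_distrib_left)
    also have "\<dots> < \<epsilon>"
      using D(2) L0 by (simp add: field_simps)
    finally show ?thesis .
  qed
  then show "\<exists>\<delta>>0. \<forall>D. D division_of \<Union>D \<and> \<Union>D \<subseteq> {a..b} \<and> (\<Sum>K\<in>D. Sup K - Inf K) < \<delta> \<longrightarrow>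
      (\<Sum>K\<in>D. \<bar>f (Sup K) - f (Inf K)\<bar>) < \<epsilon>"
    using \<open>\<epsilon> > 0\<close> L0 by (intro exI[of _ "\<epsilon> / (L + 1)"]) (simp del: sum_subtractf)
qed

lemma absolutely_continuous_fun_imp_continuous_on:
  assumes f: "absolutely_continuous_fun a b f"
  shows "continuous_on {a..b} f"
  unfolding continuous_on_iff
proof (intro ballI allI impI)
  fix x \<epsilon> :: real
  assume x: "x \<in> {a..b}" and "\<epsilon> > 0"
  then obtain \<delta> where \<delta>: "\<delta> > 0"
    "\<And>D. D division_of \<Union>D \<Longrightarrow> \<Union>D \<subseteq> {a..b} \<Longrightarrow> (\<Sum>K\<in>D. Sup K - Inf K) < \<delta> \<Longrightarrow>
        (\<Sum>K\<in>D. \<bar>f (Sup K) - f (Inf K)\<bar>) < \<epsilon>"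
    using f unfolding absolutely_continuous_fun_def by meson
  have near: "\<bar>f v - f u\<bar> < \<epsilon>" if "u \<le> v" "u \<in> {a..b}" "v \<in> {a..b}" "v - u < \<delta>" for u v
  proof -
    \<comment> \<open>A division with a single member reduces the sum in the definition to one
      increment.\<close>
    have "{{u..v}} division_of \<Union>{{u..v}}"
      using that division_of_self[of u v] by simp
    then show ?thesis
      using \<delta>(2)[of "{{u..v}}"] that by simp
  qed
  have "dist (f y) (f x) < \<epsilon>" if "y \<in> {a..b}" "dist y x < \<delta>" for y
    using near[of x y] near[of y x] x that by (cases "x \<le> y") (auto simp: dist_real_def)
  then show "\<exists>d>0. \<forall>x'\<in>{a..b}. dist x' x < d \<longrightarrow> dist (f x') (f x) < \<epsilon>"
    using \<delta>(1) by blast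
qed

section \<open>Constancy from a derivative that vanishes almost everywhere\<close>

text \<open>Compare both endpoints with \<open>x\<close>: since \<open>x\<close> lies between
  \<open>u\<close> and \<open>v\<close>, the two error bounds \<open>e * (x - u)\<close> and
  \<open>e * (v - x)\<close> add up to exactly \<open>e * (v - u)\<close>.\<close>

lemma DERIV_zero_straddle:
  fixes f :: "real \<Rightarrow> real"
  assumes "(f has_real_derivative 0) (at x)" "e > 0"
  obtains d where "d > 0"
    "\<And>u v. u \<le> x \<Longrightarrow> x \<le> v \<Longrightarrow> {u..v} \<subseteq> ball x d \<Longrightarrow> \<bar>f v - f u\<bar> \<le> e * (v - u)"
proof -
  have "(f has_derivative (*) 0) (at x)"
    using assms(1) by (simp only: has_field_derivative_def)
  then obtain d where d: "d > 0" "\<And>y. \<bar>y - x\<bar> < d \<Longrightarrow> \<bar>f y - f x\<bar> \<le> e * \<bar>y - x\<bar>"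
    using assms(2) unfolding has_derivative_at_alt by auto
  show thesis
  proof (rule that[OF d(1)])
    fix u v assume uv: "u \<le> x" "x \<le> v" "{u..v} \<subseteq> ball x d"
    then have "{u, v} \<subseteq> {u..v}"
      by simp
    with uv(3) have "u \<in> ball x d" "v \<in> ball x d"
      by blast+
    then have "\<bar>u - x\<bar> < d" "\<bar>v - x\<bar> < d"
      by (auto simp: dist_real_def)
    then have "\<bar>f u - f x\<bar> \<le> e * \<bar>u - x\<bar>" "\<bar>f v - f x\<bar> \<le> e * \<bar>v - x\<bar>"
      using d(2) by auto
    then show "\<bar>f v - f u\<bar> \<le> e * (v - u)"
      using uv by (simp add: algebra_simps)
  qed
qed

text \<open>A fine tagged division of \<open>{a..b}\<close> is split by its tags. At tags outside
  \<open>N\<close> the zero derivative bounds each increment by \<open>e\<close> times the length.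
  The intervals tagged in \<open>N\<close> lie in an open set of measure below \<delta>, so absolute
  continuity bounds their total increment by \<open>e\<close>.\<close>

lemma absolutely_continuous_fun_AE_zero_derivative_endpoints:
  assumes ac: "absolutely_continuous_fun a b f" and "a \<le> b"
    and N: "N \<in> null_sets lebesgue"
    and der: "\<And>x. x \<in> {a..b} - N \<Longrightarrow> (f has_real_derivative 0) (at x)"
  shows "f a = f b"
proof -
  have main: "\<bar>f b - f a\<bar> \<le> e * (b - a + 1)" if e: "e > 0" for e
  proof -
    obtain \<delta> where \<delta>: "\<delta> > 0"
      "\<And>D. D division_of \<Union>D \<Longrightarrow> \<Union>D \<subseteq> {a..b} \<Longrightarrow> (\<Sum>K\<in>D. Sup K - Inf K) < \<delta> \<Longrightarrow>
          (\<Sum>K\<in>D. \<bar>f (Sup K) - f (Inf K)\<bar>) < e"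
      using ac e unfolding absolutely_continuous_fun_def by meson
    obtain U where U: "open U" "N \<subseteq> U" "U - N \<in> lmeasurable" "emeasure lebesgue (U - N) < ennreal \<delta>"
      using sets_lebesgue_outer_open[OF null_setsD2[OF N] \<delta>(1)] by metis
    have "U = (U - N) \<union> N"
      using U(2) by auto
    have U_meas: "U \<in> lmeasurable"
      using U(3) N \<open>U = (U - N) \<union> N\<close>
      by (metis fmeasurable.Un fmeasurableI_null_sets)
    have "emeasure lebesgue U = emeasure lebesgue (U - N)"
      using U(3) N by (metis \<open>U = (U - N) \<union> N\<close> emeasure_Un_null_set fmeasurableD)
    then have U_small: "measure lebesgue U < \<delta>"
      using U(4) U_meas by (metis emeasure_eq_measure2 ennreal_less_iff measure_nonneg)
    \<comment> \<open>Choice of the gauge radius: at points of \<open>N\<close> the ball stays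
      inside \<open>U\<close>, at the other points of \<open>{a..b}\<close> it comes from the
      straddle estimate. Outside \<open>{a..b}\<close>, where no tag lies, any positive radius
      serves.\<close>
    have "\<exists>d>0. (x \<in> N \<longrightarrow> ball x d \<subseteq> U) \<and> (x \<in> {a..b} - N \<longrightarrow>
        (\<forall>u v. u \<le> x \<longrightarrow> x \<le> v \<longrightarrow> {u..v} \<subseteq> ball x d \<longrightarrow> \<bar>f v - f u\<bar> \<le> e * (v - u)))" for x
    proof (cases "x \<in> N")
      case True
      then show ?thesis
        using U(1,2) by (meson DiffD2 openE subsetD)
    next
      case False
      show ?thesis
      proof (cases "x \<in> {a..b}")
        case True
        then show ?thesis
          using DERIV_zero_straddle[OF der e] False by (metis DiffI)
      next
        case False
        then show ?thesis
          using \<open>x \<notin> N\<close> by (intro exI[of _ 1]) auto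
      qed
    qed
    then obtain r where r: "\<And>x. r x > 0" "\<And>x. x \<in> N \<Longrightarrow> ball x (r x) \<subseteq> U"
      "\<And>x u v. x \<in> {a..b} - N \<Longrightarrow> u \<le> x \<Longrightarrow> x \<le> v \<Longrightarrow> {u..v} \<subseteq> ball x (r x) \<Longrightarrow>
         \<bar>f v - f u\<bar> \<le> e * (v - u)"
      by metis
    have "gauge (\<lambda>x. ball x (r x))"
      using r(1) by (simp add: gauge_def)
    then obtain p where p: "p tagged_division_of {a..b}" "(\<lambda>x. ball x (r x)) fine p"
      using fine_division_exists_real by blast
    note p' = tagged_division_ofD[OF p(1)]
    have mem: "\<exists>u v. K = {u..v} \<and> u \<le> x \<and> x \<le> v \<and> Inf K = u \<and> Sup K = v \<and>
        K \<subseteq> ball x (r x)" if xK: "(x, K) \<in> p" for x K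
    proof -
      obtain u v where "K = cbox u v"
        using p'(4)[OF xK] by blast
      moreover have "x \<in> K" "K \<subseteq> ball x (r x)"
        using p'(2)[OF xK] p(2) xK by (auto simp: fine_def)
      ultimately show ?thesis
        by (intro exI[of _ u] exI[of _ v]) auto
    qed
    define q where "q = {xK \<in> p. fst xK \<in> N}"
    have "q \<subseteq> p" "finite p"
      using p'(1) by (auto simp: q_def)
    let ?v = "\<lambda>(x, K). \<bar>f (Sup K) - f (Inf K)\<bar>"
    have "q tagged_partial_division_of {a..b}"
      using tagged_partial_division_subset[OF tagged_division_of_def[THEN iffD1, THEN conjunct1, OF p(1)] \<open>q \<subseteq> p\<close>] .
    then have q_div: "q tagged_division_of \<Union>(snd ` q)" "snd ` q division_of \<Union>(snd ` q)"
      by (auto intro: tagged_partial_division_of_Union_self partial_division_of_tagged_division)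
    have sub_ab: "\<Union>(snd ` q) \<subseteq> {a..b}"
      using p'(3) \<open>q \<subseteq> p\<close> by fastforce
    have sub_U: "\<Union>(snd ` q) \<subseteq> U"
      using r(2) mem unfolding q_def by fastforce
    have len: "measure lborel K = Sup K - Inf K" "measure lebesgue K = Sup K - Inf K"
      if "K \<in> snd ` q" for K
      by (rule division_of_real_memberE[OF q_div(2) that]; simp)+
    \<comment> \<open>Members of a division have disjoint interiors, so their lengths add up to the
      measure of the union, which is contained in \<open>U\<close>.\<close>
    have "(\<Sum>K\<in>snd ` q. Sup K - Inf K) = measure lebesgue (\<Union>(snd ` q))"
      unfolding content_division[OF q_div(2), symmetric] by (rule sum.cong) (simp_all add: len)
    also have "\<dots> \<le> measure lebesgue U"
      using U_meas q_div(2) sub_U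
      by (intro measure_mono_fmeasurable fmeasurableD[OF lmeasurable_division])
    finally have "(\<Sum>K\<in>snd ` q. Sup K - Inf K) < \<delta>"
      using U_small by simp
    then have on_N: "(\<Sum>K\<in>snd ` q. \<bar>f (Sup K) - f (Inf K)\<bar>) < e"
      using \<delta>(2) q_div(2) sub_ab by blast
    \<comment> \<open>Distinct tags may share an interval, but only a degenerate one, where the increment
      vanishes; the case distinction also covers the junk values \<open>Sup {}\<close> and \<open>Inf {}\<close>.\<close>
    define w where "w K = (if measure lborel K = 0 then 0 else \<bar>f (Sup K) - f (Inf K)\<bar>)" for K
    have w: "w K = \<bar>f (Sup K) - f (Inf K)\<bar>" if "K \<in> snd ` q" for K
      using division_of_real_memberE[OF q_div(2) that] len(1)[OF that] by (auto simp: w_def)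
    have "sum ?v q = (\<Sum>(x, K)\<in>q. w K)"
      by (rule sum.cong) (auto intro!: w[symmetric] simp: image_iff Bex_def)
    also have "\<dots> = sum w (snd ` q)"
      by (rule sum.over_tagged_division_lemma[OF q_div(1)])
        (simp add: w_def content_eq_0_interior)
    finally have "sum ?v q = sum w (snd ` q)" .
    then have sum_q: "sum ?v q \<le> e"
      using on_N sum.cong[OF refl w, of "snd ` q"] by simp
    \<comment> \<open>For tags outside \<open>N\<close> the straddle estimate applies interval by
      interval; all lengths of \<open>p\<close> together give \<open>b - a\<close>.\<close>
    have "sum ?v (p - q) \<le> (\<Sum>(x, K)\<in>p - q. e * measure lborel K)"
    proof (rule sum_mono)
      fix xK assume "xK \<in> p - q"
      then obtain x K where xK: "xK = (x, K)" "(x, K) \<in> p" "x \<notin> N"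
        unfolding q_def by (cases xK) auto
      obtain u v where uv: "K = {u..v}" "u \<le> x" "x \<le> v" "K \<subseteq> ball x (r x)"
        using mem[OF xK(2)] by blast
      then have "\<bar>f v - f u\<bar> \<le> e * (v - u)"
        using r(3)[of x u v] tag_in_interval[OF p(1) xK(2)] xK(3) by auto
      then show "?v xK \<le> (case xK of (x, K) \<Rightarrow> e * measure lborel K)"
        using uv xK(1) by simp
    qed
    also have "\<dots> \<le> (\<Sum>(x, K)\<in>p. e * measure lborel K)"
      using \<open>finite p\<close> e by (intro sum_mono2) auto
    also have "\<dots> = e * (b - a)"
      using additive_content_tagged_division[of p a b] p(1) \<open>a \<le> b\<close>
      by (simp add: case_prod_unfold flip: sum_distrib_left)
    finally have sum_rest: "sum ?v (p - q) \<le> e * (b - a)" .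
    have "f b - f a = (\<Sum>(x, K)\<in>p. f (Sup K) - f (Inf K))"
      by (rule additive_tagged_division_1[OF \<open>a \<le> b\<close> p(1), symmetric])
    then have "\<bar>f b - f a\<bar> \<le> sum ?v p"
      using sum_abs[of "\<lambda>(x, K). f (Sup K) - f (Inf K)" p] by (simp add: case_prod_unfold)
    also have "\<dots> = sum ?v (p - q) + sum ?v q"
      using sum.subset_diff[OF \<open>q \<subseteq> p\<close> \<open>finite p\<close>] .
    finally show ?thesis
      using sum_q sum_rest by (simp add: algebra_simps)
  qed
  have "\<bar>f b - f a\<bar> \<le> 0"
  proof (rule field_le_epsilon)
    fix e :: real assume "e > 0"
    \<comment> \<open>Rescaling cancels the factor in \<open>main\<close>, whose summand 1 comes
      from the tags in \<open>N\<close> and keeps the divisor positive when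
      \<open>a = b\<close>.\<close>
    then show "\<bar>f b - f a\<bar> \<le> 0 + e"
      using main[of "e / (b - a + 1)"] \<open>a \<le> b\<close> by simp
  qed
  then show ?thesis by simp
qed

section \<open>Zeros and sign changes of periodic functions\<close>

text \<open>The crossing is the supremum \<open>z\<close> of the points of \<open>{s..t}\<close>
  where \<open>f\<close> is negative. Beyond it \<open>f\<close> is nonnegative, and continuity
  gives \<open>f z = 0\<close>. Finiteness of the zero set isolates \<open>z\<close> from other
  zeros, which makes the signs on both sides strict.\<close>

lemma upward_crossing_between:
  fixes f :: "real \<Rightarrow> real"
  assumes cont: "continuous_on UNIV f" and fin: "finite {x \<in> {s..t}. f x = 0}"
    and "s < t" "f s < 0" "f t > 0"
  obtains z where "s < z" "z < t" "z \<in> upward_crossings f"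
proof -
  have isC: "isCont f x" for x
    using cont by (simp add: continuous_on_eq_continuous_at)
  define A where "A = {x \<in> {s..t}. f x < 0}"
  define z where "z = Sup A"
  have A: "s \<in> A" "bdd_above A"
    using assms by (auto simp: A_def)
  have zst: "s \<le> z" "z \<le> t"
    using A unfolding z_def by (auto simp: A_def intro!: cSup_upper cSup_least)
  have below: "\<exists>a\<in>A. x < a" if "x < z" for x
    using that A less_cSup_iff[of A x] unfolding z_def by auto
  have above: "f x \<ge> 0" if "z < x" "x \<le> t" for x
  proof (rule ccontr)
    assume "\<not> f x \<ge> 0"
    then have "x \<in> A"
      using that zst by (auto simp: A_def)
    then show False
      using cSup_upper[OF _ A(2)] that(1) unfolding z_def by force
  qed
  \<comment> \<open>A positive value at \<open>z\<close> would persist nearby, yet points of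
    \<open>A\<close> lie arbitrarily close to \<open>z\<close>.\<close>
  have "f z \<le> 0"
  proof (rule ccontr)
    assume "\<not> f z \<le> 0"
    then obtain e where e: "e > 0" "\<And>y. \<bar>y - z\<bar> < e \<Longrightarrow> f y > 0"
      using isC[of z] unfolding continuous_at_eps_delta
      by (metis abs_diff_less_iff add_diff_cancel_left' diff_self dist_real_def not_le)
    obtain a where "a \<in> A" "z - e < a"
      using below[of "z - e"] e(1) by auto
    moreover have "a \<le> z"
      using cSup_upper[OF _ A(2)] \<open>a \<in> A\<close> by (simp add: z_def)
    ultimately show False
      using e(2)[of a] e(1) by (auto simp: A_def)
  qed
  then have "z < t"
    using zst \<open>f t > 0\<close> by (cases "z = t") auto
  have lim: "(f \<longlongrightarrow> f z) (at_right z)"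
    using isC[of z] by (simp add: isCont_def filterlim_at_split)
  have "f z \<ge> 0"
    using \<open>z < t\<close> above
    by (intro tendsto_lowerbound[OF lim] eventually_at_rightI[of _ t]) auto
  with \<open>f z \<le> 0\<close> have "f z = 0" by simp
  then have "s < z"
    using zst \<open>f s < 0\<close> by (cases "z = s") auto
  obtain \<delta>0 where \<delta>0: "\<delta>0 > 0" "\<And>x. x \<in> {s..t} \<Longrightarrow> f x = 0 \<Longrightarrow> x \<noteq> z \<Longrightarrow> \<delta>0 \<le> \<bar>x - z\<bar>"
    using finite_set_avoid[OF fin, of z] by (auto simp: dist_real_def abs_minus_commute)
  define \<delta> where "\<delta> = min \<delta>0 (min (z - s) (t - z))"
  have "\<delta> > 0"
    using \<delta>0(1) \<open>s < z\<close> \<open>z < t\<close> by (simp add: \<delta>_def)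
  have right: "f y > 0" if "y \<in> {z<..<z+\<delta>}" for y
    using above[of y] \<delta>0(2)[of y] that \<open>s < z\<close> by (force simp: \<delta>_def)
  have left: "f y < 0" if y: "y \<in> {z-\<delta><..<z}" for y
  proof (rule ccontr)
    assume "\<not> f y < 0"
    obtain a where a: "a \<in> A" "y < a"
      using below[of y] y by auto
    have "a \<le> z"
      using cSup_upper[OF a(1) A(2)] by (simp add: z_def)
    then have "a < z"
      using a \<open>f z = 0\<close> by (cases "a = z") (auto simp: A_def)
    \<comment> \<open>Between \<open>y\<close>, where \<open>f\<close> is nonnegative, and
      \<open>a\<close>, where it is negative, there is a zero strictly left of \<open>z\<close> but
      closer to it than \<open>\<delta>0\<close>.\<close>
    obtain x where "y \<le> x" "x \<le> a" "f x = 0"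
      using IVT2[of f a 0 y] isC a \<open>\<not> f y < 0\<close> by (auto simp: A_def)
    then show False
      using \<delta>0(2)[of x] y \<open>a < z\<close> \<open>z < t\<close> by (force simp: \<delta>_def)
  qed
  have "z \<in> upward_crossings f"
    unfolding upward_crossings_def nondegenerate_zeros_def
    using \<open>f z = 0\<close> \<open>\<delta> > 0\<close> left right by (auto intro!: exI[of _ \<delta>] mult_neg_pos)
  then show thesis
    using that \<open>s < z\<close> \<open>z < t\<close> by blast
qed

lemma finite_zeros_on_interval:
  fixes f :: "real \<Rightarrow> real"
  assumes T: "is_period f T" and fin: "finite {t \<in> {0..<T}. f t = 0}"
  shows "finite {t \<in> {a..b}. f t = 0}"
proof -
  interpret periodic_fun_simple f T
    using T by unfold_locales (simp add: is_period_def)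
  have "T > 0"
    using T by (simp add: is_period_def)
  \<comment> \<open>A zero \<open>t\<close> is a zero of the window \<open>{0..<T}\<close>
    translated by \<open>\<lfloor>t / T\<rfloor>\<close> periods, and this index takes finitely many
    values on \<open>{a..b}\<close>.\<close>
  have "{t \<in> {a..b}. f t = 0}
      \<subseteq> (\<Union>k\<in>{\<lfloor>a / T\<rfloor>..\<lfloor>b / T\<rfloor>}. (\<lambda>x. x + of_int k * T) ` {t \<in> {0..<T}. f t = 0})"
  proof
    fix t assume t: "t \<in> {t \<in> {a..b}. f t = 0}"
    define k where "k = \<lfloor>t / T\<rfloor>"
    have "k \<in> {\<lfloor>a / T\<rfloor>..\<lfloor>b / T\<rfloor>}"
      using t \<open>T > 0\<close> unfolding k_def by (auto intro!: floor_mono divide_right_mono)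
    moreover have "of_int k \<le> t / T" "t / T < of_int k + 1"
      unfolding k_def by linarith+
    then have "t - of_int k * T \<in> {0..<T}"
      using \<open>T > 0\<close> by (simp add: field_simps)
    moreover have "f (t - of_int k * T) = 0"
      using t minus_of_int[of t k] by simp
    ultimately show "t \<in> (\<Union>k\<in>{\<lfloor>a / T\<rfloor>..\<lfloor>b / T\<rfloor>}. (\<lambda>x. x + of_int k * T) ` {t \<in> {0..<T}. f t = 0})"
      by (intro UN_I[of k] image_eqI[of _ _ "t - of_int k * T"]) auto
  qed
  then show ?thesis
    by (rule finite_subset) (use fin in simp)
qed

lemma upward_crossings_minus_period:
  assumes "is_period f T" "z \<in> upward_crossings f"
  shows "z - T \<in> upward_crossings f"
proof -
  interpret periodic_fun_simple f T
    using assms by unfold_locales (simp add: is_period_def)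
  obtain \<delta> where \<delta>: "f z = 0" "\<delta> > 0"
    "\<And>x. x \<in> {z-\<delta><..<z} \<Longrightarrow> f x < 0" "\<And>x. x \<in> {z<..<z+\<delta>} \<Longrightarrow> f x > 0"
  proof -
    obtain \<delta> where "f z = 0" "\<delta> > 0" and \<delta>: "\<forall>x\<in>{z-\<delta><..<z}. \<forall>y\<in>{z<..<z+\<delta>}. f x < 0 \<and> 0 < f y"
      using assms(2) unfolding upward_crossings_def nondegenerate_zeros_def by blast
    \<comment> \<open>The definition states both signs jointly; a midpoint on one side releases the
      sign condition on the other.\<close>
    moreover have "z - \<delta> / 2 \<in> {z-\<delta><..<z}" "z + \<delta> / 2 \<in> {z<..<z+\<delta>}"
      using \<open>\<delta> > 0\<close> by auto
    ultimately show thesis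
      using that by blast
  qed
  have "f (z - T) = 0"
    using \<delta>(1) minus_1 by simp
  moreover have "f x < 0" if "x \<in> {z - T - \<delta> <..< z - T}" for x
    using \<delta>(3)[of "x + T"] that plus_1[of x] by simp
  moreover have "f x > 0" if "x \<in> {z - T <..< z - T + \<delta>}" for x
    using \<delta>(4)[of "x + T"] that plus_1[of x] by simp
  ultimately show ?thesis
    unfolding upward_crossings_def nondegenerate_zeros_def
    using \<delta>(2) by (auto intro!: exI[of _ \<delta>] mult_neg_pos)
qed

text \<open>The change point is the infimum of the negative points in the window. A positive value
  after it would be preceded by a negative one, and \<open>upward_crossing_between\<close> would
  produce a crossing that \<open>uniq\<close> excludes.\<close>

lemma sign_change_within_period:
  assumes cont: "continuous_on UNIV f" and T: "is_period f T"
    and fin: "\<And>a b. finite {t \<in> {a..b}. f t = 0}"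
    and p: "p \<in> upward_crossings f"
    and uniq: "\<And>z. z \<in> {p<..<p+T} \<Longrightarrow> z \<notin> upward_crossings f"
  obtains d where "p < d" "d < p + T" "f d = 0"
    "\<And>x. x \<in> {p<..<d} \<Longrightarrow> f x \<ge> 0" "\<And>x. x \<in> {d<..<p+T} \<Longrightarrow> f x \<le> 0"
proof -
  have "T > 0" and per: "\<And>x. f (x + T) = f x"
    using T by (auto simp: is_period_def)
  obtain \<delta>0 where "\<delta>0 > 0" and \<delta>0: "\<forall>x\<in>{p-\<delta>0<..<p}. \<forall>y\<in>{p<..<p+\<delta>0}. f x < 0 \<and> 0 < f y"
    using p unfolding upward_crossings_def by blast
  have "p - \<delta>0 / 2 \<in> {p-\<delta>0<..<p}" "p + \<delta>0 / 2 \<in> {p<..<p+\<delta>0}"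
    using \<open>\<delta>0 > 0\<close> by auto
  then have left: "\<And>x. x \<in> {p-\<delta>0<..<p} \<Longrightarrow> f x < 0"
    and right: "\<And>x. x \<in> {p<..<p+\<delta>0} \<Longrightarrow> f x > 0"
    using \<delta>0 by blast+
  \<comment> \<open>The cap \<open>T\<close> puts \<open>p + T - \<delta> / 2\<close> inside the
    window; it is the translate of a point just left of \<open>p\<close>, hence a negative
    point.\<close>
  define \<delta> where "\<delta> = min \<delta>0 T"
  have "\<delta> > 0" "\<delta> \<le> T" "\<delta> \<le> \<delta>0"
    using \<open>\<delta>0 > 0\<close> \<open>T > 0\<close> by (auto simp: \<delta>_def)
  define S where "S = {x \<in> {p<..<p+T}. f x < 0}"
  define d where "d = Inf S"
  have s0: "p + T - \<delta> / 2 \<in> S"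
    using left[of "p - \<delta> / 2"] per[of "p - \<delta> / 2"] \<open>\<delta> > 0\<close> \<open>\<delta> \<le> T\<close> \<open>\<delta> \<le> \<delta>0\<close>
    by (auto simp: S_def algebra_simps)
  have bdd: "bdd_below S"
    by (auto simp: S_def intro!: bdd_belowI[of _ p])
  \<comment> \<open>Positivity just right of \<open>p\<close> keeps every negative point at distance
    at least \<delta>, so \<open>d\<close> is strictly beyond \<open>p\<close>.\<close>
  have "p + \<delta> \<le> d"
    unfolding d_def
  proof (rule cInf_greatest)
    show "S \<noteq> {}"
      using s0 by blast
    show "p + \<delta> \<le> x" if "x \<in> S" for x
      using right[of x] that \<open>\<delta> \<le> \<delta>0\<close> by (force simp: S_def)
  qed
  then have "p < d"
    using \<open>\<delta> > 0\<close> by simp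
  have "d < p + T"
    using cInf_lower[OF s0 bdd] \<open>\<delta> > 0\<close> by (simp add: d_def)
  have nonneg: "f x \<ge> 0" if "x \<in> {p<..<d}" for x
  proof (rule ccontr)
    assume "\<not> f x \<ge> 0"
    then have "x \<in> S"
      using that \<open>d < p + T\<close> by (auto simp: S_def)
    then show False
      using cInf_lower[OF _ bdd] that by (force simp: d_def)
  qed
  have nonpos: "f x \<le> 0" if x: "x \<in> {d<..<p+T}" for x
  proof (rule ccontr)
    assume "\<not> f x \<le> 0"
    moreover obtain s where s: "s \<in> S" "s < x"
      using cInf_less_iff[of S x] s0 bdd x by (auto simp: d_def)
    ultimately obtain z where "s < z" "z < x" "z \<in> upward_crossings f"
      using upward_crossing_between[OF cont fin s(2)] by (auto simp: S_def)
    then show False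
      using uniq[of z] s x by (auto simp: S_def)
  qed
  have "isCont f d"
    using cont by (simp add: continuous_on_eq_continuous_at)
  then have lim: "(f \<longlongrightarrow> f d) (at_left d)" "(f \<longlongrightarrow> f d) (at_right d)"
    by (auto simp: isCont_def filterlim_at_split)
  have "f d \<ge> 0"
    using \<open>p < d\<close> nonneg
    by (intro tendsto_lowerbound[OF lim(1)] eventually_at_leftI[of p]) auto
  moreover have "f d \<le> 0"
    using \<open>d < p + T\<close> nonpos
    by (intro tendsto_upperbound[OF lim(2)] eventually_at_rightI[of _ "p + T"]) auto
  ultimately show thesis
    using that[OF \<open>p < d\<close> \<open>d < p + T\<close> _ nonneg nonpos] by simp
qed

section \<open>Explicit integration of the delayed equation\<close>

lemma DERIV_abs_real: "(abs has_real_derivative sgn x) (at x)" if "x \<noteq> 0" for x :: real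
proof (cases "x > 0")
  case True
  have "((\<lambda>y. y) has_real_derivative 1) (at x)"
    by (rule DERIV_ident)
  then have "(abs has_real_derivative 1) (at x)"
    by (rule has_field_derivative_transform_within_open[of _ _ _ "{0<..}"]) (use True in auto)
  then show ?thesis
    using True by simp
next
  case False
  have "((\<lambda>y. - y) has_real_derivative - 1) (at x)"
    by (rule DERIV_minus[OF DERIV_ident])
  then have "(abs has_real_derivative - 1) (at x)"
    by (rule has_field_derivative_transform_within_open[of _ _ _ "{..<0}"]) (use False that in auto)
  then show ?thesis
    using False that by simp
qed

lemma abs_sin_diff_le: "\<bar>sin x - sin y\<bar> \<le> \<bar>x - y\<bar>" for x y :: real
proof -
  have "\<bar>sin x - sin y\<bar> = 2 * \<bar>sin ((x - y) / 2)\<bar> * \<bar>cos ((x + y) / 2)\<bar>"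
    by (simp add: sin_diff_sin abs_mult)
  also have "\<dots> \<le> 2 * \<bar>sin ((x - y) / 2)\<bar> * 1"
    by (intro mult_left_mono) auto
  also have "\<dots> \<le> \<bar>x - y\<bar>"
    using abs_sin_x_le_abs_x[of "(x - y) / 2"] by simp
  finally show ?thesis .
qed

lemma dde_solution_continuous:
  assumes "dde_solution c \<tau> h"
  shows "continuous_on UNIV h"
proof -
  have "isCont h x" for x
  proof (rule continuous_on_interior)
    show "continuous_on {x - 1..x + 1} h"
      using assms absolutely_continuous_fun_imp_continuous_on
      unfolding dde_solution_def locally_absolutely_continuous_def by simp
    show "x \<in> interior {x - 1..x + 1}"
      by simp
  qed
  then show ?thesis
    by (simp add: continuous_at_imp_continuous_on)
qed

text \<open>One sign change at \<open>d\<close> turns \<open>- sgn (h (t - \<tau>))\<close> into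
  \<open>sgn (t - \<tau> - d)\<close> for almost every \<open>t\<close> in the interval, and the
  modulus is a primitive of that. The difference of \<open>h\<close> and the explicit function is
  absolutely continuous with derivative zero almost everywhere, so it is a constant
  \<open>C\<close>.\<close>

lemma dde_solution_single_sign_change:
  assumes dde: "dde_solution c \<tau> h"
    and fin: "finite {t \<in> {p..q}. h t = 0}"
    and "h p = 0" "h q = 0"
    and nonneg: "\<And>x. x \<in> {p<..<d} \<Longrightarrow> h x \<ge> 0" and nonpos: "\<And>x. x \<in> {d<..<q} \<Longrightarrow> h x \<le> 0"
  obtains C where "\<And>t. t \<in> {p + \<tau>..q + \<tau>} \<Longrightarrow>
    h t = \<bar>t - \<tau> - d\<bar> + c / (2 * pi) * sin (2 * pi * t) + C"
proof -
  define F where "F t = \<bar>t - \<tau> - d\<bar> + c / (2 * pi) * sin (2 * pi * t)" for t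
  \<comment> \<open>The modulus contributes slope 1 and the sine term slope at most
    \<open>\<bar>c\<bar>\<close>; the Lipschitz bound yields absolute continuity of
    \<open>F\<close>.\<close>
  have F_lip: "\<bar>F x - F y\<bar> \<le> (1 + \<bar>c\<bar>) * \<bar>x - y\<bar>" for x y
  proof -
    have "\<bar>c / (2 * pi) * sin (2 * pi * x) - c / (2 * pi) * sin (2 * pi * y)\<bar>
        = \<bar>c\<bar> / (2 * pi) * \<bar>sin (2 * pi * x) - sin (2 * pi * y)\<bar>"
      unfolding right_diff_distrib[symmetric] abs_mult by simp
    also have "\<dots> \<le> \<bar>c\<bar> / (2 * pi) * \<bar>2 * pi * x - 2 * pi * y\<bar>"
      by (intro mult_left_mono abs_sin_diff_le) simp
    also have "\<dots> = \<bar>c\<bar> * \<bar>x - y\<bar>"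
      unfolding right_diff_distrib[symmetric] abs_mult by simp
    finally show ?thesis
      unfolding F_def by (simp add: algebra_simps)
  qed
  have F_deriv: "(F has_real_derivative sgn (t - \<tau> - d) + c * cos (2 * pi * t)) (at t)"
    if "t - \<tau> \<noteq> d" for t
  proof -
    have "((\<lambda>t. t - \<tau> - d) has_real_derivative 1) (at t)"
      by (auto intro!: derivative_eq_intros)
    then have "((\<lambda>t. \<bar>t - \<tau> - d\<bar>) has_real_derivative sgn (t - \<tau> - d)) (at t)"
      using DERIV_chain2[where g = "\<lambda>t. t - \<tau> - d", OF DERIV_abs_real] that by fastforce
    moreover have "((\<lambda>t. c / (2 * pi) * sin (2 * pi * t)) has_real_derivative c * cos (2 * pi * t)) (at t)"
      by (auto intro!: derivative_eq_intros)
    ultimately show ?thesis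
      unfolding F_def by (rule DERIV_add)
  qed
  obtain N0 where N0: "N0 \<in> null_sets lebesgue"
    "\<And>t. t \<notin> N0 \<Longrightarrow> (h has_real_derivative - sgn (h (t - \<tau>)) + c * cos (2 * pi * t)) (at t)"
    by (rule AE_E3[OF dde[unfolded dde_solution_def, THEN conjunct2]]) auto
  \<comment> \<open>Besides the exceptional set of the equation, \<open>N\<close> contains the kink
    of \<open>F\<close> at \<open>d + \<tau>\<close> and the times whose delayed argument is a zero
    of \<open>h\<close>, where \<open>sgn\<close> would be 0.\<close>
  define N where "N = N0 \<union> insert (d + \<tau>) ((\<lambda>t. t + \<tau>) ` {t \<in> {p..q}. h t = 0})"
  have "finite (insert (d + \<tau>) ((\<lambda>t. t + \<tau>) ` {t \<in> {p..q}. h t = 0}))"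
    using fin by simp
  then have N: "N \<in> null_sets lebesgue"
    unfolding N_def by (intro null_sets.Un[OF N0(1)] negligible_finite[THEN negligible_iff_null_sets[THEN iffD1]])
  have zero: "((\<lambda>t. h t - F t) has_real_derivative 0) (at t)" if t: "t \<in> {p + \<tau>..q + \<tau>} - N" for t
  proof -
    have "t - \<tau> \<in> {p..q}" "t - \<tau> \<noteq> d" "t \<notin> N0"
      using t by (auto simp: N_def)
    have "h (t - \<tau>) \<noteq> 0"
    proof
      assume "h (t - \<tau>) = 0"
      then have "t \<in> (\<lambda>t. t + \<tau>) ` {t \<in> {p..q}. h t = 0}"
        using \<open>t - \<tau> \<in> {p..q}\<close> by (intro image_eqI[of _ _ "t - \<tau>"]) auto
      then show False
        using t by (simp add: N_def)
    qed
    \<comment> \<open>The endpoints are zeros, hence already excluded; this leaves the open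
      intervals on which the sign hypotheses speak.\<close>
    then have "t - \<tau> \<noteq> p" "t - \<tau> \<noteq> q"
      using \<open>h p = 0\<close> \<open>h q = 0\<close> by auto
    have "sgn (h (t - \<tau>)) = - sgn (t - \<tau> - d)"
    proof (cases "t - \<tau> < d")
      case True
      then have "h (t - \<tau>) \<ge> 0"
        using \<open>t - \<tau> \<in> {p..q}\<close> \<open>t - \<tau> \<noteq> p\<close> by (intro nonneg) auto
      with \<open>h (t - \<tau>) \<noteq> 0\<close> True show ?thesis
        by simp
    next
      case False
      then have "t - \<tau> > d"
        using \<open>t - \<tau> \<noteq> d\<close> by simp
      then have "h (t - \<tau>) \<le> 0"
        using \<open>t - \<tau> \<in> {p..q}\<close> \<open>t - \<tau> \<noteq> q\<close> by (intro nonpos) auto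
      with \<open>h (t - \<tau>) \<noteq> 0\<close> \<open>t - \<tau> > d\<close> show ?thesis
        by simp
    qed
    then show ?thesis
      using DERIV_diff[OF N0(2)[OF \<open>t \<notin> N0\<close>] F_deriv[OF \<open>t - \<tau> \<noteq> d\<close>]] by simp
  qed
  have const: "h t - F t = h (p + \<tau>) - F (p + \<tau>)" if t: "t \<in> {p + \<tau>..q + \<tau>}" for t
  proof -
    have "absolutely_continuous_fun (p + \<tau>) t h"
      using dde t unfolding dde_solution_def locally_absolutely_continuous_def by simp
    then have "absolutely_continuous_fun (p + \<tau>) t (\<lambda>t. h t - F t)"
      using absolutely_continuous_fun_diff lipschitz_imp_absolutely_continuous_fun[OF F_lip] by blast
    then show ?thesis
      using absolutely_continuous_fun_AE_zero_derivative_endpoints[OF _ _ N, of "p + \<tau>" t "\<lambda>t. h t - F t"]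
        zero t by simp
  qed
  show thesis
    by (rule that[of "h (p + \<tau>) - F (p + \<tau>)"]) (use const in \<open>fastforce simp: F_def\<close>)
qed

section \<open>The half-period shift and the symmetry\<close>

text \<open>For \<open>n = 2 * k + 1\<close> the phase moves by \<open>pi\<close> plus
  \<open>k\<close> full turns.\<close>

lemma sin_shift_odd_half:
  assumes "odd n"
  shows "sin (2 * pi * (t + real n / 2)) = - sin (2 * pi * t)"
proof -
  obtain k where "n = 2 * k + 1"
    using assms by (rule oddE)
  then have "2 * pi * (t + real n / 2) = 2 * pi * t + pi + 2 * pi * real k"
    by (simp add: field_simps)
  also have "sin \<dots> = sin (2 * pi * t + pi)"
    using sin_2npi[of k] cos_2npi[of k] by (simp add: sin_add mult_ac)
  finally show ?thesis
    by simp
qed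

theorem proposition3p2:
  fixes c \<tau> :: real and n :: nat and h :: "real \<Rightarrow> real"
  assumes "c \<ge> 0" and "\<tau> > 0"
    and "n > 0" and "odd n"
    and "n_1_periodic_orbit c \<tau> n h"
  shows "symmetric_orbit n h"
proof -
  have dde: "dde_solution c \<tau> h" and T: "is_period h (real n)"
    and card: "card (upward_crossings h \<inter> {0..<real n}) = 1"
    using assms(5) by (auto simp: n_1_periodic_orbit_def periodic_orbit_def prime_period_def)
  have fin: "finite {t \<in> {a..b}. h t = 0}" for a b
    using assms(5) finite_zeros_on_interval
    unfolding n_1_periodic_orbit_def periodic_orbit_def by blast
  have per: "h (t + real n) = h t" for t
    using T by (simp add: is_period_def)
  obtain p where p: "upward_crossings h \<inter> {0..<real n} = {p}"
    using card by (rule card_1_singletonE)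
  then have p_up: "p \<in> upward_crossings h" and "0 \<le> p" "p < real n"
    by auto
  \<comment> \<open>Uniqueness moves from the window \<open>{0..<real n}\<close> to the one starting
    at \<open>p\<close>: a crossing at or beyond \<open>real n\<close>, shifted back by one period,
    lands in \<open>{0..<p}\<close>.\<close>
  have uniq: "z \<notin> upward_crossings h" if z: "z \<in> {p<..<p + real n}" for z
  proof
    assume up: "z \<in> upward_crossings h"
    show False
    proof (cases "z < real n")
      case True
      then have "z \<in> upward_crossings h \<inter> {0..<real n}"
        using up z \<open>0 \<le> p\<close> by auto
      then show False
        using p z by auto
    next
      case False
      then have "z - real n \<in> upward_crossings h \<inter> {0..<real n}"
        using upward_crossings_minus_period[OF T up] z \<open>p < real n\<close> by auto
      then show False
        using p z by auto
    qed
  qed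
  obtain d where d: "p < d" "d < p + real n" "h d = 0"
    "\<And>x. x \<in> {p<..<d} \<Longrightarrow> h x \<ge> 0" "\<And>x. x \<in> {d<..<p + real n} \<Longrightarrow> h x \<le> 0"
    using sign_change_within_period[OF dde_solution_continuous[OF dde] T fin p_up uniq] by metis
  have "h p = 0"
    using p_up by (simp add: upward_crossings_def nondegenerate_zeros_def)
  have "h (p + real n) = 0"
    using per \<open>h p = 0\<close> by simp
  obtain C where C: "\<And>t. t \<in> {p + \<tau>..p + real n + \<tau>} \<Longrightarrow>
      h t = \<bar>t - \<tau> - d\<bar> + c / (2 * pi) * sin (2 * pi * t) + C"
    using dde_solution_single_sign_change[OF dde fin \<open>h p = 0\<close> \<open>h (p + real n) = 0\<close> d(4,5)] by metis
  \<comment> \<open>Two half-period shifts, each reversing the sign.\<close>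
  have "sin (2 * pi * (p + real n + \<tau>)) = sin (2 * pi * (p + \<tau>))"
    using sin_shift_odd_half[OF \<open>odd n\<close>, of "p + \<tau>"]
      sin_shift_odd_half[OF \<open>odd n\<close>, of "p + \<tau> + real n / 2"] by (simp add: add_ac)
  \<comment> \<open>Equal values of \<open>h\<close> and of the sine at both ends leave
    \<open>\<bar>p - d\<bar> = \<bar>p + real n - d\<bar>\<close>; as \<open>d\<close> lies strictly
    between, it is the midpoint.\<close>
  then have d_eq: "d = p + real n / 2"
    using C[of "p + \<tau>"] C[of "p + real n + \<tau>"] per[of "p + \<tau>"] d(1,2)
    by (simp add: add_ac)
  define g where "g t = h t + h (t + real n / 2)" for t
  interpret g: periodic_fun_simple g "real n / 2"
    using per by unfold_locales (simp add: g_def add.assoc)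
  \<comment> \<open>Here \<open>t - \<tau> \<le> d \<le> t + real n / 2 - \<tau>\<close>, so the two
    moduli open with opposite signs and sum to \<open>real n / 2\<close>, while the sine terms
    cancel.\<close>
  have g_half: "g t = real n / 2 + 2 * C" if "t \<in> {p + \<tau>..p + \<tau> + real n / 2}" for t
    using C[of t] C[of "t + real n / 2"] that sin_shift_odd_half[OF \<open>odd n\<close>, of t]
    by (simp add: g_def d_eq)
  have g_const: "g t = real n / 2 + 2 * C" for t
  proof -
    \<comment> \<open>The number of half periods by which \<open>t\<close> is moved back into the
      interval of \<open>g_half\<close>.\<close>
    define k where "k = \<lfloor>(t - (p + \<tau>)) / (real n / 2)\<rfloor>"
    have "of_int k \<le> (t - (p + \<tau>)) / (real n / 2)" "(t - (p + \<tau>)) / (real n / 2) \<le> of_int k + 1"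
      unfolding k_def by linarith+
    then have "t - of_int k * (real n / 2) \<in> {p + \<tau>..p + \<tau> + real n / 2}"
      using \<open>n > 0\<close> by (simp add: field_simps)
    then show ?thesis
      using g_half g.minus_of_int[of t k] by metis
  qed
  \<comment> \<open>The half-period shift of \<open>p\<close> is \<open>d\<close>, so both summands
    are zeros of \<open>h\<close>; this fixes the constant value of \<open>g\<close>.\<close>
  have "g p = 0"
    using \<open>h p = 0\<close> d(3) by (simp add: g_def d_eq)
  then have "h t + h (t + real n / 2) = 0" for t
    using g_const[of t] g_const[of p] by (simp add: g_def)
  then show ?thesis
    unfolding symmetric_orbit_def eq_neg_iff_add_eq_0 by blast
qed

end
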